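(* Let $n$ and $N$ be positive integers and let $\mathcal{B}=\{v_1,\dots,v_N\}$ be a Parseval frame in $\mathbb{R}^n$ consisting of nonzero vectors. Let $\ell_j=\|v_j\|$ and let $\theta_{ij}$ be the angle between $v_i$ and $v_j$. Then for every $i\in\{1,\dots,N\}$ $$\sum_{j=1}^{N}\ell_j^2\cos^2\theta_{ij}=1\qquad\text{and}\qquad\sum_{j=1}^{N}\ell_j^2\sin^2\theta_{ij}=n-1.$$
   Context: $\langle\cdot,\cdot\rangle$ and $\|\cdot\|$ are the usual scalar product and norm on $\mathbb{R}^n$. A (finite, indexed) family $\{v_1,\dots,v_N\}$ of vectors in $\mathbb{R}^n$ is a Parseval frame if $\sum_{j=1}^N\langle v,v_j\rangle^2=\|v\|^2$ for every $v\in\mathbb{R}^n$. The angle $\theta_{ij}$ satisfies $\langle v_i,v_j\rangle=\ell_i\ell_j\cos\theta_{ij}$; in particular $\theta_{ii}=0$. *)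

theory Defs
  imports "HOL-Analysis.Analysis"
begin

text \<open>Frames are indexed families, so repeated vectors are allowed and counted with multiplicity.\<close>

definition parseval_frame :: "'i set \<Rightarrow> ('i \<Rightarrow> 'a::real_inner) \<Rightarrow> bool" where
  "parseval_frame I v \<longleftrightarrow> finite I \<and> (\<forall>x. (\<Sum>j\<in>I. (x \<bullet> v j)\<^sup>2) = (norm x)\<^sup>2)"

text \<open>The unoriented angle, in the interval from 0 to \<open>pi\<close>; it is meaningful for nonzero
  vectors only.\<close>

definition angle :: "'a::real_inner \<Rightarrow> 'a \<Rightarrow> real" where
  "angle u w = arccos ((u \<bullet> w) / (norm u * norm w))"

lemma angle_unique:
  assumes "u \<noteq> 0" "w \<noteq> 0"
  shows "angle u w = t \<longleftrightarrow> 0 \<le> t \<and> t \<le> pi \<and> u \<bullet> w = norm u * norm w * cos t"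
proof -
  have pos: "norm u * norm w > 0" using assms by simp
  have "\<bar>(u \<bullet> w) / (norm u * norm w)\<bar> \<le> 1"
    using Cauchy_Schwarz_ineq2[of u w] pos by (simp add: abs_divide)
  then have b: "-1 \<le> (u \<bullet> w) / (norm u * norm w)" "(u \<bullet> w) / (norm u * norm w) \<le> 1"
    by linarith+
  have e: "u \<bullet> w = norm u * norm w * cos t \<longleftrightarrow> (u \<bullet> w) / (norm u * norm w) = cos t"
    using assms by (auto simp: field_simps)
  show ?thesis
    unfolding angle_def e using b arccos_lbound arccos_ubound cos_arccos arccos_cos by metis
qed

end

theory Submission
  imports Defs
begin

text \<open>
  Apply the Parseval identity to the frame vector \<open>v i\<close> itself:
  \<open>\<ell>\<^sub>i\<^sup>2 = \<Sum>j. \<langle>v\<^sub>i, v\<^sub>j\<rangle>\<^sup>2 = \<ell>\<^sub>i\<^sup>2 * (\<Sum>j. \<ell>\<^sub>j\<^sup>2 * cos\<^sup>2 \<theta>\<^sub>i\<^sub>j)\<close>.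
  Since \<open>\<ell>\<^sub>i \<noteq> 0\<close>, cancelling \<open>\<ell>\<^sub>i\<^sup>2\<close> gives the cosine identity
  (\<open>parseval_frame_sum_cos_angle\<close>). By \<open>sin\<^sup>2 + cos\<^sup>2 = 1\<close>, the sine sum is
  \<open>\<Sum>j. \<ell>\<^sub>j\<^sup>2\<close> minus the cosine sum, so it remains to know that the squared lengths of a Parseval
  frame add up to the dimension (\<open>parseval_frame_sum_norm_squared\<close>): both numbers are the trace of
  the frame operator \<open>x \<mapsto> \<Sum>j. \<langle>x, v\<^sub>j\<rangle> v\<^sub>j\<close>, which is the identity.
\<close>

lemma inner_eq_norm_cos_angle:
  assumes "u \<noteq> 0" "w \<noteq> 0"
  shows "u \<bullet> w = norm u * norm w * cos (angle u w)"
  using angle_unique[OF assms] by blast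

text \<open>Expanding each squared length in an orthonormal basis and exchanging the two sums leaves, for
  every basis vector \<open>b\<close>, the Parseval sum of \<open>b\<close>, which is \<open>1\<close>.\<close>

lemma parseval_frame_sum_norm_squared:
  fixes v :: "'i \<Rightarrow> 'a::euclidean_space"
  assumes "parseval_frame I v"
  shows "(\<Sum>j\<in>I. (norm (v j))\<^sup>2) = real DIM('a)"
proof -
  have "(norm (v j))\<^sup>2 = (\<Sum>b\<in>Basis. (b \<bullet> v j)\<^sup>2)" for j
    unfolding power2_norm_eq_inner
    by (subst euclidean_inner) (simp add: power2_eq_square inner_commute)
  then have "(\<Sum>j\<in>I. (norm (v j))\<^sup>2) = (\<Sum>j\<in>I. \<Sum>b\<in>Basis. (b \<bullet> v j)\<^sup>2)"
    by simp
  also have "\<dots> = (\<Sum>b\<in>Basis. \<Sum>j\<in>I. (b \<bullet> v j)\<^sup>2)"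
    by (rule sum.swap)
  also have "\<dots> = (\<Sum>b\<in>(Basis :: 'a set). 1)"
    using assms by (intro sum.cong) (auto simp: parseval_frame_def)
  finally show ?thesis by simp
qed

lemma parseval_frame_sum_cos_angle:
  fixes v :: "'i \<Rightarrow> 'a::real_inner"
  assumes "parseval_frame I v" and "\<forall>j\<in>I. v j \<noteq> 0" and "x \<noteq> 0"
  shows "(\<Sum>j\<in>I. (norm (v j))\<^sup>2 * (cos (angle x (v j)))\<^sup>2) = 1"
proof -
  have "(norm x)\<^sup>2 * (\<Sum>j\<in>I. (norm (v j))\<^sup>2 * (cos (angle x (v j)))\<^sup>2)
      = (\<Sum>j\<in>I. (x \<bullet> v j)\<^sup>2)"
    using assms(2,3)
    by (auto simp: sum_distrib_left inner_eq_norm_cos_angle power_mult_distrib mult.assoc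
        intro!: sum.cong)
  also have "\<dots> = (norm x)\<^sup>2"
    using assms(1) by (simp add: parseval_frame_def)
  finally show ?thesis
    using \<open>x \<noteq> 0\<close> by simp
qed

theorem theorem1p3:
  fixes N :: nat and v :: "nat \<Rightarrow> real ^ 'n"
  assumes "N \<ge> 1"
    and "parseval_frame {1..N} v"
    and "\<forall>j\<in>{1..N}. v j \<noteq> 0"
  shows "\<forall>i\<in>{1..N}.
    (\<Sum>j=1..N. (norm (v j))\<^sup>2 * (cos (angle (v i) (v j)))\<^sup>2) = 1 \<and>
    (\<Sum>j=1..N. (norm (v j))\<^sup>2 * (sin (angle (v i) (v j)))\<^sup>2) = real CARD('n) - 1"
proof
  fix i assume "i \<in> {1..N}"
  then have cos_sum: "(\<Sum>j=1..N. (norm (v j))\<^sup>2 * (cos (angle (v i) (v j)))\<^sup>2) = 1"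
    using assms(3) by (intro parseval_frame_sum_cos_angle[OF assms(2,3)]) auto
  have "(\<Sum>j=1..N. (norm (v j))\<^sup>2 * (sin (angle (v i) (v j)))\<^sup>2)
      = (\<Sum>j=1..N. (norm (v j))\<^sup>2) - (\<Sum>j=1..N. (norm (v j))\<^sup>2 * (cos (angle (v i) (v j)))\<^sup>2)"
    by (simp add: sin_squared_eq right_diff_distrib sum_subtractf)
  also have "\<dots> = real CARD('n) - 1"
    using cos_sum parseval_frame_sum_norm_squared[OF assms(2)] by simp
  finally show "(\<Sum>j=1..N. (norm (v j))\<^sup>2 * (cos (angle (v i) (v j)))\<^sup>2) = 1 \<and>
      (\<Sum>j=1..N. (norm (v j))\<^sup>2 * (sin (angle (v i) (v j)))\<^sup>2) = real CARD('n) - 1"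
    using cos_sum by blast
qed

end
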